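(* Let $\lambda$ be a $\sigma$-finite measure on $(\mathbb{R},\mathcal{B}(\mathbb{R}))$. Let $f:\mathbb{R}\to[0,\infty)$ be a continuous function such that for some $\delta>0$ and for all $s\in(-\delta,\delta)$, $$M(s;f)=\int_{\mathbb{R}} e^{sx}f(x)\,\lambda(dx)<\infty .$$ Then $f$ possesses finite moments of all orders, i.e. for all $n\in\mathbb{N}_0=\{0,1,2,\dots\}$, $$\int_{\mathbb{R}} x^n f(x)\,\lambda(dx)\in\mathbb{R}.$$
   Context: $\mathcal{B}(\mathbb{R})$ is the Borel $\sigma$-algebra. The function $M(\cdot;f):\mathbb{R}\to[0,\infty]$ is called the Laplace transform of $f$ (with respect to $\lambda$). The conclusion means that each integral $\int x^n f\,d\lambda$ exists as a finite Lebesgue integral. *)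

theory Defs
  imports "HOL-Analysis.Analysis"
begin

(* The integrand is coerced with ennreal, which truncates negative values to 0;
   the definition is meant for f >= 0 only, where the coercion is harmless. *)
definition laplace_transform :: "real measure \<Rightarrow> (real \<Rightarrow> real) \<Rightarrow> real \<Rightarrow> ennreal" where
  "laplace_transform \<mu> f s = (\<integral>\<^sup>+ x. ennreal (exp (s * x) * f x) \<partial>\<mu>)"

end

theory Submission
  imports Defs
begin

text \<open>
  With \<open>s = \<delta> / 2\<close>, the bound \<open>y ^ n \<le> n! * exp y\<close> at \<open>y = s * \<bar>x\<bar>\<close> dominates \<open>\<bar>x\<bar> ^ n * f x\<close> by a
  multiple of \<open>exp (s * x) * f x + exp (- s * x) * f x\<close>, which is integrable by hypothesis.
\<close>

text \<open>For \<open>y \<ge> 0\<close> all terms of the exponential series are nonnegative, so the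
  single term of index \<open>n\<close>, taken as a sum over \<open>{n}\<close>, is at most the
  whole series.\<close>

lemma power_le_fact_exp:
  fixes y :: real
  assumes "0 \<le> y"
  shows "y ^ n \<le> fact n * exp y"
proof -
  have "(\<Sum>k\<in>{n}. y ^ k /\<^sub>R fact k) \<le> (\<Sum>k. y ^ k /\<^sub>R fact k)"
    using assms by (intro sum_le_suminf summable_exp_generic) auto
  then show ?thesis
    by (simp add: exp_def field_simps)
qed

text \<open>Whatever the sign of \<open>x\<close>, \<open>exp (s * \<bar>x\<bar>)\<close> is one of
  the two summands and the other is positive. The sum removes the absolute value from the exponent,
  leaving the kernels of the Laplace transform at \<open>s\<close> and \<open>- s\<close>.\<close>

lemma abs_power_le_exp_sum:
  fixes s x :: real
  assumes "s > 0"
  shows "\<bar>x\<bar> ^ n \<le> fact n / s ^ n * (exp (s * x) + exp (- s * x))"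
proof -
  have "exp (s * \<bar>x\<bar>) \<le> exp (s * x) + exp (- s * x)"
    by (cases "x \<ge> 0") (auto simp: abs_if)
  then have "fact n * exp (s * \<bar>x\<bar>) \<le> fact n * (exp (s * x) + exp (- s * x))"
    by (intro mult_left_mono) auto
  moreover have "(s * \<bar>x\<bar>) ^ n \<le> fact n * exp (s * \<bar>x\<bar>)"
    using assms by (intro power_le_fact_exp) auto
  ultimately have "(s * \<bar>x\<bar>) ^ n \<le> fact n * (exp (s * x) + exp (- s * x))"
    by linarith
  then show ?thesis
    using assms by (simp add: power_mult_distrib field_simps)
qed

text \<open>Since \<open>f\<close> is nonnegative, the coercion to \<open>ennreal\<close> loses
  nothing, and a finite nonnegative integral gives Bochner integrability.\<close>

lemma integrable_exp_if_laplace_transform_finite: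
  assumes [measurable]: "f \<in> borel_measurable \<mu>" and [measurable_cong]: "sets \<mu> = sets borel"
    and "\<And>x. 0 \<le> f x" and "laplace_transform \<mu> f s < \<infinity>"
  shows "integrable \<mu> (\<lambda>x. exp (s * x) * f x)"
  by (rule integrableI_nonneg)
    (use assms(3,4) in \<open>auto simp: laplace_transform_def\<close>)

theorem proposition1:
  fixes \<mu> :: "real measure" and f :: "real \<Rightarrow> real" and \<delta> :: real
  assumes "sigma_finite_measure \<mu>" and "sets \<mu> = sets borel"
    and "\<And>x. 0 \<le> f x" and "continuous_on UNIV f"
    and "\<delta> > 0" and "\<And>s. s \<in> {-\<delta><..<\<delta>} \<Longrightarrow> laplace_transform \<mu> f s < \<infinity>"
  shows "\<forall>n::nat. integrable \<mu> (\<lambda>x. x ^ n * f x)"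
proof
  fix n :: nat
  note [measurable_cong] = assms(2)
  \<comment> \<open>Continuity enters here, as the source of measurability.\<close>
  have "f \<in> borel_measurable borel"
    using assms(4) by (rule borel_measurable_continuous_onI)
  then have f [measurable]: "f \<in> borel_measurable \<mu>"
    by (simp cong: measurable_cong_sets add: assms(2))
  \<comment> \<open>Any point strictly between \<open>0\<close> and \<open>\<delta>\<close> works:
    \<open>s\<close> and \<open>- s\<close> must both lie in the interval of finiteness, and
    \<open>s ^ n\<close> is a divisor.\<close>
  define s where "s = \<delta> / 2"
  have s: "s > 0" "s \<in> {-\<delta><..<\<delta>}" "- s \<in> {-\<delta><..<\<delta>}"
    using assms(5) by (auto simp: s_def)
  let ?g = "\<lambda>x. fact n / s ^ n * (exp (s * x) * f x + exp (- s * x) * f x)"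
  have "integrable \<mu> ?g"
    using integrable_exp_if_laplace_transform_finite[OF f assms(2,3) assms(6)] s(2,3)
    by (intro integrable_mult_right Bochner_Integration.integrable_add)
  then show "integrable \<mu> (\<lambda>x. x ^ n * f x)"
  proof (rule Bochner_Integration.integrable_bound)
    show "(\<lambda>x. x ^ n * f x) \<in> borel_measurable \<mu>"
      by measurable
    have "norm (x ^ n * f x) \<le> norm (?g x)" for x
    proof -
      have "norm (x ^ n * f x) = \<bar>x\<bar> ^ n * f x"
        using assms(3)[of x] by (simp add: abs_mult power_abs)
      \<comment> \<open>The pointwise bound survives multiplication by \<open>f x\<close> because
        \<open>f x \<ge> 0\<close>.\<close>
      also have "\<dots> \<le> fact n / s ^ n * (exp (s * x) + exp (- s * x)) * f x"
        using abs_power_le_exp_sum[OF s(1)] assms(3) by (rule mult_right_mono)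
      also have "\<dots> = ?g x"
        by (simp add: algebra_simps)
      also have "\<dots> \<le> norm (?g x)"
        unfolding real_norm_def by (rule abs_ge_self)
      finally show ?thesis .
    qed
    then show "AE x in \<mu>. norm (x ^ n * f x) \<le> norm (?g x)"
      by simp
  qed
qed

end
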